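(* Consider a poristic triangle family, i.e. the set of all triangles having a given fixed incircle (radius $r$) and a given fixed circumcircle (radius $R$), and put $\rho=r/R$. For a triangle $T$ of the family let $a_9\ge b_9$ be the semi-axis lengths of its Circumbilliard. Then the ratio $a_9/b_9$ is the same for all triangles of the family, and it is given by $$\frac{a_9}{b_9}=\sqrt{\frac{\rho^2+2(\rho+1)\sqrt{1-2\rho}+2}{\rho(\rho+4)}} .$$
   Context: A triangle $T$ is a (billiard) 3-periodic of an ellipse $E$ (circles allowed) if its three vertices lie on $E$ and at each vertex the normal line to $E$ is the internal angle bisector of $T$ at that vertex. The Circumbilliard (CB) of a triangle $T$ is the unique ellipse of which $T$ is a billiard 3-periodic; equivalently, it is the ellipse through the three vertices of $T$ centered at the Mittenpunkt $X_9$ of $T$ (the point where the lines from each excenter through the midpoint of the corresponding side concur). *)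

theory Defs
  imports "HOL-Analysis.Analysis"
begin

type_synonym point = "real ^ 2"

definition nondegenerate_triangle :: "point \<Rightarrow> point \<Rightarrow> point \<Rightarrow> bool" where
  "nondegenerate_triangle A B C \<longleftrightarrow> \<not> collinear {A, B, C}"

text \<open>The classical notion of tangency, which agrees with the differential one for the
  curves considered here: a line is tangent to a circle or an ellipse at \<open>P\<close> iff \<open>P\<close> is its
  only common point with the curve. It is not meant for other point sets.\<close>

definition tangent_line_at :: "point set \<Rightarrow> point \<Rightarrow> point set \<Rightarrow> bool" where
  "tangent_line_at S P L \<longleftrightarrow> (\<exists>Q. Q \<noteq> P \<and> L = affine hull {P, Q}) \<and> L \<inter> S = {P}"

definition normal_line_at :: "point set \<Rightarrow> point \<Rightarrow> point set \<Rightarrow> bool" where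
  "normal_line_at S P N \<longleftrightarrow>
     (\<exists>Q M. Q \<noteq> P \<and> tangent_line_at S P (affine hull {P, Q}) \<and>
            M \<noteq> P \<and> orthogonal (Q - P) (M - P) \<and> N = affine hull {P, M})"

definition angle_at :: "point \<Rightarrow> point \<Rightarrow> point \<Rightarrow> real" where
  "angle_at P X Y = arccos (((X - P) \<bullet> (Y - P)) / (norm (X - P) * norm (Y - P)))"

text \<open>The internal bisector at the vertex \<open>A\<close> of the triangle \<open>A B C\<close>, as a full line. Taking
  \<open>D\<close> on the opposite side excludes the external bisector.\<close>

definition internal_bisector :: "point \<Rightarrow> point \<Rightarrow> point \<Rightarrow> point set \<Rightarrow> bool" where
  "internal_bisector A B C L \<longleftrightarrow>
     (\<exists>D \<in> open_segment B C. angle_at A B D = angle_at A D C \<and> L = affine hull {A, D})"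

definition is_incircle :: "point \<Rightarrow> real \<Rightarrow> point \<Rightarrow> point \<Rightarrow> point \<Rightarrow> bool" where
  "is_incircle ic r A B C \<longleftrightarrow>
     0 < r \<and> sphere ic r \<subseteq> convex hull {A, B, C} \<and>
     (\<exists>P. tangent_line_at (sphere ic r) P (affine hull {B, C})) \<and>
     (\<exists>P. tangent_line_at (sphere ic r) P (affine hull {C, A})) \<and>
     (\<exists>P. tangent_line_at (sphere ic r) P (affine hull {A, B}))"

definition is_circumcircle :: "point \<Rightarrow> real \<Rightarrow> point \<Rightarrow> point \<Rightarrow> point \<Rightarrow> bool" where
  "is_circumcircle oc R A B C \<longleftrightarrow> 0 < R \<and> {A, B, C} \<subseteq> sphere oc R"

definition poristic_family ::
    "point \<Rightarrow> real \<Rightarrow> point \<Rightarrow> real \<Rightarrow> (point \<times> point \<times> point) set" where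
  "poristic_family ic r oc R =
     {(A, B, C). nondegenerate_triangle A B C \<and>
                 is_incircle ic r A B C \<and> is_circumcircle oc R A B C}"

text \<open>Ellipses are point sets; circles are the case \<open>a = b\<close>.\<close>

definition has_semi_axes :: "point set \<Rightarrow> real \<Rightarrow> real \<Rightarrow> bool" where
  "has_semi_axes E a b \<longleftrightarrow>
     0 < b \<and> b \<le> a \<and>
     (\<exists>c u v. norm u = 1 \<and> norm v = 1 \<and> orthogonal u v \<and>
        E = {c + x *\<^sub>R u + y *\<^sub>R v | x y. x\<^sup>2 / a\<^sup>2 + y\<^sup>2 / b\<^sup>2 = 1})"

definition is_ellipse :: "point set \<Rightarrow> bool" where
  "is_ellipse E \<longleftrightarrow> (\<exists>a b. has_semi_axes E a b)"

definition semi_major :: "point set \<Rightarrow> real" where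
  "semi_major E = (THE a. \<exists>b. has_semi_axes E a b)"

definition semi_minor :: "point set \<Rightarrow> real" where
  "semi_minor E = (THE b. \<exists>a. has_semi_axes E a b)"

definition billiard_3_periodic :: "point set \<Rightarrow> point \<Rightarrow> point \<Rightarrow> point \<Rightarrow> bool" where
  "billiard_3_periodic E A B C \<longleftrightarrow>
     is_ellipse E \<and> nondegenerate_triangle A B C \<and> {A, B, C} \<subseteq> E \<and>
     (\<exists>N. normal_line_at E A N \<and> internal_bisector A B C N) \<and>
     (\<exists>N. normal_line_at E B N \<and> internal_bisector B C A N) \<and>
     (\<exists>N. normal_line_at E C N \<and> internal_bisector C A B N)"

definition circumbilliard :: "point \<Rightarrow> point \<Rightarrow> point \<Rightarrow> point set" where
  "circumbilliard A B C = (THE E. billiard_3_periodic E A B C)"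

definition circumbilliard_ratio :: "point \<times> point \<times> point \<Rightarrow> real" where
  "circumbilliard_ratio = (\<lambda>(A, B, C).
     semi_major (circumbilliard A B C) / semi_minor (circumbilliard A B C))"

end

theory Submission
  imports Defs
begin

text \<open>
  An ellipse is the level set \<open>Q (x - z) = 1\<close> of a positive definite quadratic form \<open>Q\<close> about its
  centre \<open>z\<close>, and its semi-axes satisfy \<open>tr Q = 1 / a\<^sup>2 + 1 / b\<^sup>2\<close> and \<open>det Q = 1 / (a\<^sup>2 b\<^sup>2)\<close>. Hence
  \<open>(tr Q)\<^sup>2 / det Q = (k + 1)\<^sup>2 / k\<close> with \<open>k = (a / b)\<^sup>2\<close>, and this quotient, which ignores the scale of
  \<open>Q\<close>, determines the axis ratio.

  The billiard condition becomes a condition on \<open>Q\<close> alone (\<open>billiard_3_periodic_conic_iff\<close>). With \<open>B\<close>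
  the polar form of \<open>Q\<close>, a chord from a vertex \<open>P\<close> along \<open>w\<close> that ends on the ellipse satisfies
  \<open>2 B (P - z, w) = - Q w\<close>, and \<open>w\<close> is tangent at \<open>P\<close> iff \<open>B (P - z, w) = 0\<close>. If the two sides at
  \<open>P\<close> are the vectors \<open>e\<close>, \<open>f\<close>, then the normal is the internal bisector iff the external bisector
  \<open>|f| e - |e| f\<close> is tangent, that is, iff \<open>|f| Q e = |e| Q f\<close>. At all three vertices together: \<open>Q\<close>
  is proportional to the side length on the three side vectors.

  Three such values determine a binary form, so the circumbilliard is unique
  (\<open>circumbilliard_form_unique\<close>). It exists because the form with values \<open>a, b, c\<close> at the side vectors
  is positive definite exactly when \<open>2 a b + 2 b c + 2 c a > a\<^sup>2 + b\<^sup>2 + c\<^sup>2\<close>, which follows from the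
  triangle inequalities; the centre and the scale are then those of the circumcircle of the triangle
  in the metric of the form (\<open>circumbilliard_exists\<close>).

  Finally the trace and the determinant of \<open>Q\<close> can be read off in the basis \<open>e, f\<close> as symmetric
  functions of \<open>a, b, c\<close>. By Heron's formula and by \<open>X = r (a + b + c)\<close> and \<open>a b c = 2 R X\<close> for twice
  the area \<open>X\<close>, the perimeter cancels and \<open>(tr Q)\<^sup>2 / det Q = 4 (r + R)\<^sup>2 / (r (r + 4 R))\<close>
  (\<open>billiard_trace_det\<close>). So \<open>k\<close> is the larger root of a quadratic equation that depends only on
  \<open>\<rho>\<close>.
\<close>

section \<open>Plane vectors and binary quadratic forms\<close>

definition cross2 :: "real ^ 2 \<Rightarrow> real ^ 2 \<Rightarrow> real" where
  "cross2 x y = x $ 1 * y $ 2 - x $ 2 * y $ 1"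

definition bform :: "real \<Rightarrow> real \<Rightarrow> real \<Rightarrow> real ^ 2 \<Rightarrow> real ^ 2 \<Rightarrow> real" where
  "bform p q s x y = p * x $ 1 * y $ 1 + q * (x $ 1 * y $ 2 + x $ 2 * y $ 1) + s * x $ 2 * y $ 2"

definition qform :: "real \<Rightarrow> real \<Rightarrow> real \<Rightarrow> real ^ 2 \<Rightarrow> real" where
  "qform p q s x = bform p q s x x"

definition central_conic :: "real \<Rightarrow> real \<Rightarrow> real \<Rightarrow> real ^ 2 \<Rightarrow> (real ^ 2) set" where
  "central_conic p q s z = {x. qform p q s (x - z) = 1}"

lemma inner_2: "(x :: real ^ 2) \<bullet> y = x $ 1 * y $ 1 + x $ 2 * y $ 2"
  by (simp add: inner_vec_def sum_2)

lemma norm2_sq: "(norm (x :: real ^ 2))\<^sup>2 = (x $ 1)\<^sup>2 + (x $ 2)\<^sup>2"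
  unfolding power2_norm_eq_inner inner_2 by (simp add: power2_eq_square)

lemma vec2_eq_iff: "(x :: real ^ 2) = y \<longleftrightarrow> x $ 1 = y $ 1 \<and> x $ 2 = y $ 2"
  by (simp add: vec_eq_iff forall_2)

lemma bform_linear:
  "bform p q s x (y + z) = bform p q s x y + bform p q s x z"
  "bform p q s x (y - z) = bform p q s x y - bform p q s x z"
  "bform p q s x (t *\<^sub>R y) = t * bform p q s x y"
  by (simp_all add: bform_def algebra_simps)

lemma bform_commute: "bform p q s x y = bform p q s y x"
  by (simp add: bform_def algebra_simps)

lemma qform_add: "qform p q s (x + y) = qform p q s x + 2 * bform p q s x y + qform p q s y"
  by (simp add: bform_def qform_def algebra_simps)

lemma qform_diff: "qform p q s (x - y) = qform p q s x - 2 * bform p q s x y + qform p q s y"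
  by (simp add: bform_def qform_def algebra_simps)

lemma qform_scaleR: "qform p q s (t *\<^sub>R x) = t\<^sup>2 * qform p q s x"
  by (simp add: bform_def qform_def algebra_simps power2_eq_square)

lemma qform_minus: "qform p q s (- x) = qform p q s x"
  by (simp add: bform_def qform_def)

lemma qform_minus_commute: "qform p q s (x - y) = qform p q s (y - x)"
  using qform_minus[of p q s "x - y"] by simp

lemma qform_pos:
  assumes "0 < p" "q\<^sup>2 < p * s" "x \<noteq> 0"
  shows "0 < qform p q s x"
proof -
  have eq: "p * qform p q s x = (p * x $ 1 + q * x $ 2)\<^sup>2 + (p * s - q\<^sup>2) * (x $ 2)\<^sup>2"
    by (simp add: bform_def qform_def algebra_simps power2_eq_square)
  have "0 < p * qform p q s x"
  proof (cases "x $ 2 = 0")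
    case True
    then have "x $ 1 \<noteq> 0" using assms(3) by (simp add: vec2_eq_iff)
    then show ?thesis using True assms(1) unfolding eq by simp
  next
    case False
    then have "0 < (p * s - q\<^sup>2) * (x $ 2)\<^sup>2" using assms(2) by simp
    then show ?thesis unfolding eq by (simp add: add_nonneg_pos)
  qed
  then show ?thesis using assms(1) by (simp add: zero_less_mult_iff)
qed

text \<open>Let \<open>S\<close> be the matrix with columns \<open>e, f\<close>, so \<open>det S = cross2 e f\<close>. The Gram matrix of the form is
  \<open>S\<^sup>T Q S\<close>, whence the determinant; with \<open>G = S\<^sup>T S\<close> the trace of \<open>Q\<close> is that of \<open>G^(-1) S\<^sup>T Q S\<close>, and
  \<open>det G \<cdot> G^(-1)\<close> is the adjugate. This turns lengths of sides into invariants of \<open>Q\<close>.\<close>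

lemma qform_det_in_basis:
  "qform p q s e * qform p q s f - (bform p q s e f)\<^sup>2 = (p * s - q\<^sup>2) * (cross2 e f)\<^sup>2"
  by (simp add: bform_def qform_def cross2_def algebra_simps power2_eq_square)

lemma qform_trace_in_basis:
  "qform p q s e * (norm f)\<^sup>2 + qform p q s f * (norm e)\<^sup>2 - 2 * bform p q s e f * (e \<bullet> f)
     = (p + s) * (cross2 e f)\<^sup>2"
  unfolding bform_def qform_def cross2_def norm2_sq inner_2 by algebra

text \<open>Lagrange's identity in the plane, giving the strict Cauchy--Schwarz inequality for independent
  vectors.\<close>

lemma cross2_sq_plus_inner_sq: "(cross2 e f)\<^sup>2 + (e \<bullet> f)\<^sup>2 = (norm e * norm f)\<^sup>2"
  unfolding power_mult_distrib norm2_sq cross2_def inner_2 by algebra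

lemma abs_inner_less_norm_mult:
  assumes "cross2 e f \<noteq> 0"
  shows "\<bar>e \<bullet> f\<bar> < norm e * norm f"
proof -
  have "0 < (cross2 e f)\<^sup>2" using assms by simp
  then have "\<bar>e \<bullet> f\<bar>\<^sup>2 < (norm e * norm f)\<^sup>2"
    using cross2_sq_plus_inner_sq[of e f] unfolding power2_abs by linarith
  then show ?thesis by (rule power2_less_imp_less) simp
qed

lemma cross2_basis:
  assumes "cross2 e f \<noteq> 0"
  obtains y z where "w = y *\<^sub>R e + z *\<^sub>R f"
proof
  have "cross2 e f *\<^sub>R w = cross2 w f *\<^sub>R e + cross2 e w *\<^sub>R f"
    by (simp add: vec2_eq_iff cross2_def algebra_simps)
  then have "(1 / cross2 e f) *\<^sub>R (cross2 e f *\<^sub>R w)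
      = (1 / cross2 e f) *\<^sub>R (cross2 w f *\<^sub>R e + cross2 e w *\<^sub>R f)" by (rule arg_cong)
  then show "w = (cross2 w f / cross2 e f) *\<^sub>R e + (cross2 e w / cross2 e f) *\<^sub>R f"
    using assms by (simp add: scaleR_right_distrib)
qed

lemma collinear_iff_cross2: "collinear {A, B, C} \<longleftrightarrow> cross2 (B - A) (C - A) = 0"
proof -
  have "collinear {A, B, C} \<longleftrightarrow> collinear {0, B - A, C - A}"
    using collinear_3[of B A C] by (simp add: insert_commute)
  also have "\<dots> \<longleftrightarrow> cross2 (B - A) (C - A) = 0"
  proof
    assume "collinear {0, B - A, C - A}"
    then consider "B - A = 0" | "C - A = 0" | k where "C - A = k *\<^sub>R (B - A)"
      unfolding collinear_lemma by blast
    then show "cross2 (B - A) (C - A) = 0"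
      by cases (simp_all only: cross2_def, simp_all)
  next
    assume 0: "cross2 (B - A) (C - A) = 0"
    show "collinear {0, B - A, C - A}"
    proof (cases "B - A = 0")
      case False
      define e where "e = B - A"
      define f where "f = C - A"
      have n: "e \<bullet> e \<noteq> 0" using False by (simp add: e_def)
      have "(e \<bullet> e) *\<^sub>R f = (e \<bullet> f) *\<^sub>R e"
        using 0[folded e_def f_def] unfolding vec2_eq_iff inner_2 cross2_def
        by (simp, algebra)
      then have "f = (e \<bullet> f / (e \<bullet> e)) *\<^sub>R e"
        using n by (simp add: vec2_eq_iff field_simps)
      then show ?thesis unfolding collinear_lemma e_def f_def by blast
    qed (simp add: collinear_lemma)
  qed
  finally show ?thesis .
qed

lemma cross2_vertex_cycle: "cross2 (C - B) (A - B) = cross2 (B - A) (C - A)"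
  by (simp add: cross2_def algebra_simps)

lemma cross2_nonzero_imp:
  assumes "cross2 e f \<noteq> 0"
  shows "e \<noteq> 0" "f \<noteq> 0" "e \<noteq> f"
  using assms by (auto simp: cross2_def)

lemma parallel_if_both_perpendicular_2:
  fixes d g w :: "real ^ 2"
  assumes "d \<noteq> 0" "g \<noteq> 0" "g \<bullet> d = 0" "w \<bullet> d = 0"
  obtains k where "w = k *\<^sub>R g"
proof
  have n: "g \<bullet> g \<noteq> 0" using assms(2) by simp
  have "cross2 w g * d $ 1 = 0" "cross2 w g * d $ 2 = 0"
    using assms(3,4) unfolding inner_2 cross2_def by algebra+
  then have c: "cross2 w g = 0" using assms(1) by (auto simp: vec2_eq_iff)
  have "(g \<bullet> g) *\<^sub>R w = (w \<bullet> g) *\<^sub>R g"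
    using c unfolding vec2_eq_iff inner_2 cross2_def by (simp, algebra)
  then show "w = (w \<bullet> g / (g \<bullet> g)) *\<^sub>R g"
    using n by (simp add: vec2_eq_iff field_simps)
qed

section \<open>Ellipses as conics of positive definite forms\<close>

text \<open>The form is \<open>(w \<bullet> u)\<^sup>2 / a\<^sup>2 + (w \<bullet> v)\<^sup>2 / b\<^sup>2\<close>, whose eigenvalues are \<open>1 / a\<^sup>2\<close> and \<open>1 / b\<^sup>2\<close>; trace and
  determinant are recorded because they are the quantities computed from the triangle later.\<close>

lemma conic_of_semi_axes:
  assumes "has_semi_axes E a b"
  obtains p q s z where "0 < p" "q\<^sup>2 < p * s" "E = central_conic p q s z"
    "p + s = 1 / a\<^sup>2 + 1 / b\<^sup>2" "p * s - q\<^sup>2 = (1 / a\<^sup>2) * (1 / b\<^sup>2)"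
proof -
  obtain z u v where ab: "0 < b" "b \<le> a" and u: "norm u = 1" and v: "norm v = 1"
    and uv: "orthogonal u v"
    and E: "E = {z + x *\<^sub>R u + y *\<^sub>R v | x y. x\<^sup>2 / a\<^sup>2 + y\<^sup>2 / b\<^sup>2 = 1}"
    using assms unfolding has_semi_axes_def by blast
  define u1 u2 v1 v2 where uvd: "u1 = u $ 1" "u2 = u $ 2" "v1 = v $ 1" "v2 = v $ 2"
  have on: "u1\<^sup>2 + u2\<^sup>2 = 1" "v1\<^sup>2 + v2\<^sup>2 = 1" "u1 * v1 + u2 * v2 = 0"
    using u v uv norm2_sq[of u] norm2_sq[of v] by (simp_all add: uvd orthogonal_def inner_2)
  \<comment> \<open>\<open>\<epsilon> = \<plusminus>1\<close> is the orientation of \<open>u, v\<close>, so \<open>v\<close> is \<open>\<epsilon>\<close> times the quarter turn of \<open>u\<close>.\<close>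
  define \<epsilon> where "\<epsilon> = u1 * v2 - u2 * v1"
  have v1: "v1 = - \<epsilon> * u2" and v2: "v2 = \<epsilon> * u1" and \<epsilon>: "\<epsilon>\<^sup>2 = 1"
    using on unfolding \<epsilon>_def by algebra+
  have rows: "u1\<^sup>2 + v1\<^sup>2 = 1" "u2\<^sup>2 + v2\<^sup>2 = 1" "u1 * u2 + v1 * v2 = 0"
    using on(1) \<epsilon> unfolding v1 v2 by algebra+
  define \<alpha> \<beta> where "\<alpha> = 1 / a\<^sup>2" and "\<beta> = 1 / b\<^sup>2"
  have pos: "0 < \<alpha>" "0 < \<beta>" using ab by (simp_all add: \<alpha>_def \<beta>_def)
  define p q s where pqs: "p = \<alpha> * u1\<^sup>2 + \<beta> * v1\<^sup>2" "q = \<alpha> * u1 * u2 + \<beta> * v1 * v2"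
    "s = \<alpha> * u2\<^sup>2 + \<beta> * v2\<^sup>2"
  have tr: "p + s = \<alpha> + \<beta>"
    using on(1,2) unfolding pqs by algebra
  have det: "p * s - q\<^sup>2 = \<alpha> * \<beta>"
  proof -
    have "p * s - q\<^sup>2 = \<alpha> * \<beta> * \<epsilon>\<^sup>2" unfolding pqs \<epsilon>_def by algebra
    then show ?thesis using \<epsilon> by simp
  qed
  have p: "0 < p"
  proof (cases "u1 = 0")
    case True
    then have "v1\<^sup>2 = 1" using rows(1) by simp
    then show ?thesis using True pos by (simp add: pqs)
  next
    case False
    then show ?thesis using pos by (simp add: pqs add_pos_nonneg)
  qed
  have qf: "qform p q s w = \<alpha> * (w \<bullet> u)\<^sup>2 + \<beta> * (w \<bullet> v)\<^sup>2" for w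
    by (simp add: qform_def bform_def pqs inner_2 uvd algebra_simps power2_eq_square)
  have split: "w = (w \<bullet> u) *\<^sub>R u + (w \<bullet> v) *\<^sub>R v" for w
    unfolding vec2_eq_iff inner_2
    using rows unfolding uvd by (simp, algebra)
  have "E = central_conic p q s z"
  proof (intro set_eqI iffI)
    fix x assume "x \<in> E"
    then obtain i j where x: "x = z + i *\<^sub>R u + j *\<^sub>R v" and ij: "i\<^sup>2 / a\<^sup>2 + j\<^sup>2 / b\<^sup>2 = 1"
      unfolding E by blast
    have "u \<bullet> u = 1" "v \<bullet> v = 1" "u \<bullet> v = 0" "v \<bullet> u = 0"
      using u v uv by (simp_all add: norm_eq_1 orthogonal_def inner_commute)
    then have "(x - z) \<bullet> u = i" "(x - z) \<bullet> v = j"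
      by (simp_all add: x inner_add_left)
    then show "x \<in> central_conic p q s z" using ij by (simp add: central_conic_def qf \<alpha>_def \<beta>_def)
  next
    fix x assume "x \<in> central_conic p q s z"
    then have "((x - z) \<bullet> u)\<^sup>2 / a\<^sup>2 + ((x - z) \<bullet> v)\<^sup>2 / b\<^sup>2 = 1"
      by (simp add: central_conic_def qf \<alpha>_def \<beta>_def)
    moreover have "x = z + ((x - z) \<bullet> u) *\<^sub>R u + ((x - z) \<bullet> v) *\<^sub>R v"
      using split[of "x - z"] by (simp add: algebra_simps)
    ultimately show "x \<in> E" unfolding E by blast
  qed
  moreover have "q\<^sup>2 < p * s" using det pos mult_pos_pos[OF pos] by linarith
  ultimately show ?thesis using that p tr det unfolding \<alpha>_def \<beta>_def by blast
qed

lemma is_ellipse_conic: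
  assumes "0 < p" "q\<^sup>2 < p * s"
  shows "is_ellipse (central_conic p q s z)"
proof -
  obtain \<rho> \<theta> where pol: "(p - s) / 2 = \<rho> * cos \<theta>" "q = \<rho> * sin \<theta>"
    using polar_Ex by blast
  define t where "t = \<theta> / 2"
  define u v :: "real ^ 2" where "u = vector [cos t, sin t]" and "v = vector [- sin t, cos t]"
  have [simp]: "u $ 1 = cos t" "u $ 2 = sin t" "v $ 1 = - sin t" "v $ 2 = cos t"
    by (simp_all add: u_def v_def)
  have sc: "(sin t)\<^sup>2 + (cos t)\<^sup>2 = 1" by simp
  have ortho: "norm u = 1" "norm v = 1" "orthogonal u v"
    by (simp_all add: norm_eq_1 inner_2 orthogonal_def power2_eq_square[symmetric])
  have th: "cos \<theta> = (cos t)\<^sup>2 - (sin t)\<^sup>2" "sin \<theta> = 2 * sin t * cos t"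
    using cos_double[of t] sin_double[of t] by (simp_all add: t_def)
  \<comment> \<open>Rotating by half the polar angle of \<open>((p - s) / 2, q)\<close> removes the mixed term.\<close>
  have cross: "bform p q s u v = 0"
    using pol sc unfolding th bform_def by (simp, algebra)
  have "u \<noteq> 0" "v \<noteq> 0" using ortho by auto
  then have pos: "0 < qform p q s u" "0 < qform p q s v"
    using assms by (simp_all add: qform_pos)
  \<comment> \<open>The form may be larger on either axis, so both orders of the axes occur.\<close>
  have main: "is_ellipse (central_conic p q s z)"
    if uv: "norm u = 1" "norm v = 1" "orthogonal u v" and c0: "bform p q s u v = 0"
      and pos: "0 < qform p q s u" and le: "qform p q s u \<le> qform p q s v" for u v
  proof -
    define a b where "a = 1 / sqrt (qform p q s u)" and "b = 1 / sqrt (qform p q s v)"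
    have ab: "0 < b" "b \<le> a" using pos le by (simp_all add: a_def b_def frac_le)
    have q: "qform p q s (x *\<^sub>R u + y *\<^sub>R v) = x\<^sup>2 / a\<^sup>2 + y\<^sup>2 / b\<^sup>2" for x y
      using pos le c0
      by (simp add: qform_add qform_scaleR bform_linear bform_commute[of p q s "x *\<^sub>R u"]
          bform_commute[of p q s v u] a_def b_def power_divide)
    have cr: "cross2 u v \<noteq> 0"
    proof
      assume "cross2 u v = 0"
      then show False using uv cross2_sq_plus_inner_sq[of u v] by (simp add: orthogonal_def)
    qed
    have "central_conic p q s z = {z + x *\<^sub>R u + y *\<^sub>R v | x y. x\<^sup>2 / a\<^sup>2 + y\<^sup>2 / b\<^sup>2 = 1}"
    proof (intro set_eqI iffI)
      fix x assume x: "x \<in> central_conic p q s z"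
      obtain i j where ij: "x - z = i *\<^sub>R u + j *\<^sub>R v" using cross2_basis[OF cr] by blast
      have "x = z + i *\<^sub>R u + j *\<^sub>R v" using ij by (simp add: algebra_simps)
      moreover have "i\<^sup>2 / a\<^sup>2 + j\<^sup>2 / b\<^sup>2 = 1" using x ij q[of i j] by (simp add: central_conic_def)
      ultimately show "x \<in> {z + x *\<^sub>R u + y *\<^sub>R v | x y. x\<^sup>2 / a\<^sup>2 + y\<^sup>2 / b\<^sup>2 = 1}" by blast
    next
      fix x assume "x \<in> {z + x *\<^sub>R u + y *\<^sub>R v | x y. x\<^sup>2 / a\<^sup>2 + y\<^sup>2 / b\<^sup>2 = 1}"
      then obtain i j where "x = z + i *\<^sub>R u + j *\<^sub>R v" "i\<^sup>2 / a\<^sup>2 + j\<^sup>2 / b\<^sup>2 = 1" by blast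
      then show "x \<in> central_conic p q s z" using q[of i j] by (simp add: central_conic_def add.assoc)
    qed
    then show ?thesis using ab uv unfolding is_ellipse_def has_semi_axes_def by blast
  qed
  show ?thesis
  proof (cases "qform p q s u \<le> qform p q s v")
    case True
    then show ?thesis using main[of u v] ortho cross pos by blast
  next
    case False
    then show ?thesis
      using main[of v u] ortho cross pos bform_commute[of p q s u v]
      by (simp add: orthogonal_commute)
  qed
qed

section \<open>Tangents, normals and bisectors\<close>

text \<open>On the line \<open>P + t w\<close> the equation of the conic reads \<open>t (2 B (P - z, w) + t Q w) = 0\<close> with
  \<open>Q w > 0\<close>; its second root coincides with \<open>t = 0\<close> iff the linear coefficient vanishes.\<close>

lemma tangent_line_at_conic:
  assumes "0 < p" "q\<^sup>2 < p * s" and P: "P \<in> central_conic p q s z" and w: "w \<noteq> 0"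
  shows "tangent_line_at (central_conic p q s z) P (affine hull {P, P + w}) \<longleftrightarrow>
    bform p q s (P - z) w = 0"
proof -
  let ?b = "bform p q s (P - z) w" and ?q = "qform p q s w"
  have q: "0 < ?q" using qform_pos assms by blast
  have mem: "P + t *\<^sub>R w \<in> central_conic p q s z \<longleftrightarrow> t * (2 * ?b + t * ?q) = 0" for t
  proof -
    have shift: "P + t *\<^sub>R w - z = (P - z) + t *\<^sub>R w" by simp
    have "qform p q s (P + t *\<^sub>R w - z) = 1 + t * (2 * ?b + t * ?q)"
      unfolding shift qform_add qform_scaleR bform_linear
      using P by (simp add: central_conic_def power2_eq_square distrib_left)
    then show ?thesis by (simp add: central_conic_def)
  qed
  have hull: "affine hull {P, P + w} = range (\<lambda>t. P + t *\<^sub>R w)"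
    by (simp add: affine_hull_2_alt)
  have line: "\<exists>Q. Q \<noteq> P \<and> affine hull {P, P + w} = affine hull {P, Q}"
    using w by (intro exI[of _ "P + w"]) simp
  show ?thesis
  proof
    assume "tangent_line_at (central_conic p q s z) P (affine hull {P, P + w})"
    then have int: "affine hull {P, P + w} \<inter> central_conic p q s z = {P}"
      by (simp add: tangent_line_at_def)
    define t where "t = - 2 * ?b / ?q"
    have "P + t *\<^sub>R w \<in> central_conic p q s z" unfolding mem using q by (simp add: t_def)
    moreover have "P + t *\<^sub>R w \<in> affine hull {P, P + w}" unfolding hull by blast
    ultimately have "P + t *\<^sub>R w = P" using int by blast
    then show "?b = 0" using w q by (simp add: t_def)
  next
    assume b: "?b = 0"
    have "affine hull {P, P + w} \<inter> central_conic p q s z = {P}"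
    proof -
      have "x = P" if x: "x \<in> affine hull {P, P + w}" "x \<in> central_conic p q s z" for x
      proof -
        obtain t where t: "x = P + t *\<^sub>R w" using x(1) unfolding hull by blast
        have "t * (2 * ?b + t * ?q) = 0" using x(2) unfolding t mem .
        then show ?thesis using q b t by simp
      qed
      moreover have "P \<in> affine hull {P, P + w}" by (simp add: hull_inc)
      ultimately show ?thesis using P by blast
    qed
    then show "tangent_line_at (central_conic p q s z) P (affine hull {P, P + w})"
      using line by (simp add: tangent_line_at_def)
  qed
qed

text \<open>The tangent direction is perpendicular to the normal direction \<open>d\<close>, hence a multiple of any
  chosen nonzero \<open>g\<close> perpendicular to \<open>d\<close>.\<close>

lemma normal_line_at_conic:
  assumes "0 < p" "q\<^sup>2 < p * s" and P: "P \<in> central_conic p q s z"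
    and d: "d \<noteq> 0" and g: "g \<noteq> 0" and perp: "g \<bullet> d = 0"
  shows "normal_line_at (central_conic p q s z) P (affine hull {P, P + d}) \<longleftrightarrow>
    bform p q s (P - z) g = 0"
proof
  assume "normal_line_at (central_conic p q s z) P (affine hull {P, P + d})"
  then obtain Q M where Q: "Q \<noteq> P" and t: "tangent_line_at (central_conic p q s z) P (affine hull {P, Q})"
    and M: "M \<noteq> P" and o: "orthogonal (Q - P) (M - P)"
    and h: "affine hull {P, P + d} = affine hull {P, M}"
    unfolding normal_line_at_def by blast
  have "P + d \<in> affine hull {P, M}" using h by (metis hull_inc insertI1 insert_commute)
  then have "d \<in> range (\<lambda>k. k *\<^sub>R (M - P))" by (force simp: affine_hull_2_alt)
  then obtain k where k: "d = k *\<^sub>R (M - P)" by blast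
  have "(Q - P) \<bullet> d = 0" using o by (simp add: k orthogonal_def)
  then obtain m where m: "Q - P = m *\<^sub>R g" using parallel_if_both_perpendicular_2 d g perp by blast
  then have "m \<noteq> 0" using Q by auto
  moreover have "bform p q s (P - z) (Q - P) = 0"
    using tangent_line_at_conic[OF assms(1-3), of "Q - P"] t Q by simp
  ultimately show "bform p q s (P - z) g = 0" unfolding m by (simp add: bform_linear)
next
  assume "bform p q s (P - z) g = 0"
  then have "tangent_line_at (central_conic p q s z) P (affine hull {P, P + g})"
    using tangent_line_at_conic[OF assms(1-3) g] by simp
  then show "normal_line_at (central_conic p q s z) P (affine hull {P, P + d})"
    unfolding normal_line_at_def
    using d g perp by (intro exI[of _ "P + g"] exI[of _ "P + d"]) (simp add: orthogonal_def)
qed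

text \<open>For \<open>D = (1 - t) B + t C\<close> the difference of the two cosines at \<open>A\<close> is, up to a positive factor,
  \<open>((1 - t) c - t b) (b c - e \<bullet> f)\<close>, and the second factor is positive by the strict Cauchy--Schwarz
  inequality. So \<open>D\<close> divides the side in the ratio \<open>c : b\<close> of the adjacent sides, and \<open>D - A\<close> is
  proportional to \<open>b e + c f\<close>.\<close>

lemma internal_bisector_iff:
  assumes nc: "cross2 (B - A) (C - A) \<noteq> 0"
  shows "internal_bisector A B C L \<longleftrightarrow>
    L = affine hull {A, A + (norm (C - A) *\<^sub>R (B - A) + norm (B - A) *\<^sub>R (C - A))}"
proof -
  define e f b c where efbc: "e = B - A" "f = C - A" "b = norm f" "c = norm e"
  have nc: "cross2 e f \<noteq> 0" using nc by (simp add: efbc)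
  note ef = cross2_nonzero_imp[OF nc]
  have bc: "0 < b" "0 < c" using ef by (simp_all add: efbc)
  have sq: "b * b = f \<bullet> f" "c * c = e \<bullet> e"
    by (simp_all add: efbc power2_norm_eq_inner power2_eq_square[symmetric])
  have BC: "B \<noteq> C" using ef by (auto simp: efbc)
  have lt: "e \<bullet> f < b * c"
    using abs_inner_less_norm_mult[OF nc] by (simp add: efbc mult.commute)
  define t0 where "t0 = c / (b + c)"
  have t0: "0 < t0" "t0 < 1" using bc by (simp_all add: t0_def)
  have ang: "angle_at A B (A + d) = angle_at A (A + d) C \<longleftrightarrow> t = t0"
    if d: "d = (1 - t) *\<^sub>R e + t *\<^sub>R f" and d0: "d \<noteq> 0" for d t
  proof -
    have n: "0 < norm d" using d0 by simp
    let ?x = "(e \<bullet> d) / (c * norm d)" and ?y = "(d \<bullet> f) / (norm d * b)"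
    have "\<bar>e \<bullet> d\<bar> \<le> c * norm d" "\<bar>d \<bullet> f\<bar> \<le> norm d * b"
      using Cauchy_Schwarz_ineq2 by (simp_all add: efbc)
    then have "\<bar>?x\<bar> \<le> 1" "\<bar>?y\<bar> \<le> 1"
      using n bc by (simp_all add: abs_mult divide_le_eq)
    then have "arccos ?x = arccos ?y \<longleftrightarrow> ?x = ?y" by (rule arccos_eq_iff[OF conjI])
    also have "\<dots> \<longleftrightarrow> b * (e \<bullet> d) = c * (d \<bullet> f)"
      using n bc by (simp add: field_simps)
    also have "\<dots> \<longleftrightarrow> b * (e \<bullet> d) - c * (d \<bullet> f) = 0" by simp
    also have "b * (e \<bullet> d) - c * (d \<bullet> f) = ((1 - t) * c - t * b) * (b * c - e \<bullet> f)"
      unfolding d inner_add_left inner_add_right inner_scaleR_left inner_scaleR_right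
        sq[symmetric] by (simp add: algebra_simps)
    also have "\<dots> = 0 \<longleftrightarrow> t = t0"
      using lt bc unfolding mult_eq_0_iff t0_def by (auto simp: field_simps)
    finally show ?thesis by (simp add: angle_at_def efbc)
  qed
  have dne: "(1 - t) *\<^sub>R e + t *\<^sub>R f \<noteq> 0" for t
  proof
    assume 0: "(1 - t) *\<^sub>R e + t *\<^sub>R f = 0"
    have "cross2 e ((1 - t) *\<^sub>R e + t *\<^sub>R f) = t * cross2 e f"
      "cross2 ((1 - t) *\<^sub>R e + t *\<^sub>R f) f = (1 - t) * cross2 e f"
      by (simp_all add: cross2_def algebra_simps)
    then show False using nc unfolding 0 by (auto simp: cross2_def)
  qed
  have pt: "(1 - t) *\<^sub>R B + t *\<^sub>R C = A + ((1 - t) *\<^sub>R e + t *\<^sub>R f)" for t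
    by (simp add: efbc algebra_simps)
  have "internal_bisector A B C L \<longleftrightarrow>
    (\<exists>t. 0 < t \<and> t < 1 \<and> t = t0 \<and> L = affine hull {A, A + ((1 - t) *\<^sub>R e + t *\<^sub>R f)})"
    unfolding internal_bisector_def Bex_def in_segment using ang[OF refl dne] BC
    by (auto simp: pt)
  also have "\<dots> \<longleftrightarrow> L = affine hull {A, A + ((1 - t0) *\<^sub>R e + t0 *\<^sub>R f)}"
    using t0 by auto
  also have "affine hull {A, A + ((1 - t0) *\<^sub>R e + t0 *\<^sub>R f)} = affine hull {A, A + (b *\<^sub>R e + c *\<^sub>R f)}"
  proof -
    have e1: "(1 - t0) *\<^sub>R e + t0 *\<^sub>R f = (1 / (b + c)) *\<^sub>R (b *\<^sub>R e + c *\<^sub>R f)"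
      using bc by (simp add: t0_def scaleR_right_distrib field_simps)
    have e2: "range (\<lambda>t. A + t *\<^sub>R (k *\<^sub>R x)) = range (\<lambda>t. A + t *\<^sub>R x)"
      if "k \<noteq> 0" for k :: real and x :: "real ^ 2"
    proof (intro subset_antisym subsetI)
      fix y assume "y \<in> range (\<lambda>t. A + t *\<^sub>R x)"
      then obtain t where "y = A + t *\<^sub>R x" by blast
      then have "y = A + (t / k) *\<^sub>R (k *\<^sub>R x)" using that by simp
      then show "y \<in> range (\<lambda>t. A + t *\<^sub>R (k *\<^sub>R x))" by blast
    qed auto
    have "1 / (b + c) \<noteq> 0" using bc by simp
    from e2[OF this] show ?thesis unfolding affine_hull_2_alt e1 by (simp only: add_diff_cancel_left')
  qed
  finally show ?thesis by (simp add: efbc)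
qed

text \<open>The linear part of the conic's equation at \<open>A\<close> is thus fixed on chords by the form itself, which
  eliminates the centre from the billiard condition.\<close>

lemma conic_bform_chord:
  assumes "A \<in> central_conic p q s z" "B \<in> central_conic p q s z"
  shows "bform p q s (A - z) (B - A) = - qform p q s (B - A) / 2"
  using assms qform_add[of p q s "A - z" "B - A"] by (simp add: central_conic_def)

text \<open>The normal is the internal bisector iff the external bisector direction \<open>g = b e - c f\<close> is
  tangent; the chord relation turns \<open>B (A - z, g) = 0\<close> into \<open>b Q e = c Q f\<close>.\<close>

lemma normal_bisects_iff:
  assumes pd: "0 < p" "q\<^sup>2 < p * s"
    and A: "A \<in> central_conic p q s z" and B: "B \<in> central_conic p q s z" and C: "C \<in> central_conic p q s z"
    and nc: "cross2 (B - A) (C - A) \<noteq> 0"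
  shows "(\<exists>N. normal_line_at (central_conic p q s z) A N \<and> internal_bisector A B C N) \<longleftrightarrow>
    norm (C - A) * qform p q s (B - A) = norm (B - A) * qform p q s (C - A)"
proof -
  define e f b c where efbc: "e = B - A" "f = C - A" "b = norm f" "c = norm e"
  have nc': "cross2 e f \<noteq> 0" using nc by (simp add: efbc)
  have bc: "0 < b" "0 < c" using cross2_nonzero_imp[OF nc'] by (simp_all add: efbc)
  define d g where "d = b *\<^sub>R e + c *\<^sub>R f" and "g = b *\<^sub>R e - c *\<^sub>R f"
  have "cross2 d f = b * cross2 e f" "cross2 g f = b * cross2 e f"
    by (simp_all add: d_def g_def cross2_def algebra_simps)
  then have "d \<noteq> 0" "g \<noteq> 0" using bc nc' by (auto simp: cross2_def)
  moreover have "g \<bullet> d = 0"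
  proof -
    have "e \<bullet> e = c * c" "f \<bullet> f = b * b"
      by (simp_all add: efbc power2_norm_eq_inner power2_eq_square[symmetric])
    then show ?thesis
      unfolding g_def d_def inner_add_right inner_diff_left inner_scaleR_left inner_scaleR_right
      by (simp add: inner_commute[of f e] algebra_simps)
  qed
  ultimately have "normal_line_at (central_conic p q s z) A (affine hull {A, A + d}) \<longleftrightarrow>
      bform p q s (A - z) g = 0"
    using normal_line_at_conic[OF pd A] by blast
  also have "\<dots> \<longleftrightarrow> 2 * bform p q s (A - z) g = 0" by simp
  also have "2 * bform p q s (A - z) g = c * qform p q s f - b * qform p q s e"
  proof -
    have "bform p q s (A - z) e = - qform p q s e / 2" "bform p q s (A - z) f = - qform p q s f / 2"
      using conic_bform_chord[OF A B] conic_bform_chord[OF A C] by (simp_all add: efbc)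
    then show ?thesis unfolding g_def bform_linear by simp
  qed
  finally show ?thesis
    unfolding internal_bisector_iff[OF nc] d_def efbc by auto
qed

text \<open>The conditions at the three vertices equate the ratios \<open>Q w / |w|\<close> of the two adjacent sides, so
  the ratio has a common value \<open>l\<close> on all three sides.\<close>

lemma billiard_3_periodic_conic_iff:
  assumes pd: "0 < p" "q\<^sup>2 < p * s"
  shows "billiard_3_periodic (central_conic p q s z) A B C \<longleftrightarrow>
    nondegenerate_triangle A B C \<and> {A, B, C} \<subseteq> central_conic p q s z \<and>
    (\<exists>l > 0. qform p q s (C - B) = l * norm (C - B) \<and> qform p q s (A - C) = l * norm (A - C) \<and>
       qform p q s (B - A) = l * norm (B - A))"
proof (cases "nondegenerate_triangle A B C \<and> {A, B, C} \<subseteq> central_conic p q s z")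
  case True
  then have nc: "cross2 (B - A) (C - A) \<noteq> 0"
    and on: "A \<in> central_conic p q s z" "B \<in> central_conic p q s z" "C \<in> central_conic p q s z"
    by (auto simp: nondegenerate_triangle_def collinear_iff_cross2)
  have nc2: "cross2 (C - B) (A - B) \<noteq> 0" and nc3: "cross2 (A - C) (B - C) \<noteq> 0"
    using nc by (simp_all add: cross2_vertex_cycle)
  have AB: "B - A \<noteq> 0" using cross2_nonzero_imp[OF nc] by simp
  have BC: "C - B \<noteq> 0" using cross2_nonzero_imp[OF nc2] by simp
  have CA: "A - C \<noteq> 0" using cross2_nonzero_imp[OF nc3] by simp
  define l where "l = qform p q s (B - A) / norm (B - A)"
  have l: "0 < l" using qform_pos[OF pd AB] AB by (simp add: l_def)
  let ?Q = "qform p q s"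
  have "billiard_3_periodic (central_conic p q s z) A B C \<longleftrightarrow>
     norm (A - C) * ?Q (B - A) = norm (B - A) * ?Q (A - C) \<and>
     norm (B - A) * ?Q (C - B) = norm (C - B) * ?Q (B - A) \<and>
     norm (C - B) * ?Q (A - C) = norm (A - C) * ?Q (C - B)"
    unfolding billiard_3_periodic_def
      normal_bisects_iff[OF pd on(1) on(2) on(3) nc]
      normal_bisects_iff[OF pd on(2) on(3) on(1) nc2]
      normal_bisects_iff[OF pd on(3) on(1) on(2) nc3]
    using True is_ellipse_conic[OF pd, of z]
      qform_minus_commute[of p q s C A] qform_minus_commute[of p q s A B]
      qform_minus_commute[of p q s B C]
      norm_minus_commute[of C A] norm_minus_commute[of A B] norm_minus_commute[of B C]
    by simp
  also have "\<dots> \<longleftrightarrow> ?Q (C - B) = l * norm (C - B) \<and> ?Q (A - C) = l * norm (A - C) \<and>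
     ?Q (B - A) = l * norm (B - A)"
    (is "?L \<longleftrightarrow> ?R")
  proof
    assume ?L
    then show ?R using AB by (simp add: l_def field_simps)
  next
    assume ?R
    then show ?L by (simp only: mult_ac)
  qed
  also have "\<dots> \<longleftrightarrow> (\<exists>l > 0. ?Q (C - B) = l * norm (C - B) \<and> ?Q (A - C) = l * norm (A - C) \<and>
       ?Q (B - A) = l * norm (B - A))"
    using l AB by (auto simp: l_def)
  finally show ?thesis using True by blast
next
  case False
  then show ?thesis by (auto simp: billiard_3_periodic_def)
qed

section \<open>Existence and uniqueness of the circumbilliard\<close>

text \<open>The values on the three side vectors make the two forms proportional, with factor \<open>m\<close>. The linear
  parts at \<open>A\<close> are proportional with the same factor, because they are determined on chords, and both
  constant terms at \<open>A\<close> vanish. So the two equations differ by the factor \<open>m\<close> and have the same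
  solutions. Equality of the forms themselves is what makes the semi-axes well defined.\<close>

lemma circumbilliard_form_unique:
  assumes pd: "0 < p" "q\<^sup>2 < p * s" and pd': "0 < p'" "q'\<^sup>2 < p' * s'"
    and bil: "billiard_3_periodic (central_conic p q s z) A B C"
    and bil': "billiard_3_periodic (central_conic p' q' s' z') A B C"
  shows "central_conic p' q' s' z' = central_conic p q s z" "p' = p" "q' = q" "s' = s"
proof -
  let ?Q = "qform p q s" and ?Q' = "qform p' q' s'"
  let ?b = "bform p q s" and ?b' = "bform p' q' s'"
  define e f where ef: "e = B - A" "f = C - A"
  from bil obtain l where nc: "cross2 e f \<noteq> 0"
    and on: "A \<in> central_conic p q s z" "B \<in> central_conic p q s z" "C \<in> central_conic p q s z"
    and l: "0 < l" "?Q (C - B) = l * norm (C - B)" "?Q (A - C) = l * norm (A - C)"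
       "?Q (B - A) = l * norm (B - A)"
    unfolding billiard_3_periodic_conic_iff[OF pd] nondegenerate_triangle_def
      collinear_iff_cross2 ef by auto
  from bil' obtain l' where
    on': "A \<in> central_conic p' q' s' z'" "B \<in> central_conic p' q' s' z'" "C \<in> central_conic p' q' s' z'"
    and l': "0 < l'" "?Q' (C - B) = l' * norm (C - B)" "?Q' (A - C) = l' * norm (A - C)"
       "?Q' (B - A) = l' * norm (B - A)"
    unfolding billiard_3_periodic_conic_iff[OF pd'] by auto
  define m where "m = l' / l"
  have m: "0 < m" using l l' by (simp add: m_def)
  have e: "?Q' e = m * ?Q e" using l l' by (simp add: m_def ef)
  have f: "?Q' f = m * ?Q f" using l l' qform_minus_commute[of _ _ _ C A] by (simp add: m_def ef)
  have fe: "?Q' (f - e) = m * ?Q (f - e)" using l l' by (simp add: m_def ef)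
  have bef: "?b' e f = m * ?b e f"
    using fe e f unfolding qform_diff[of _ _ _ f e] bform_commute[of _ _ _ f e]
    by (simp add: algebra_simps)
  have Q: "?Q' w = m * ?Q w" for w
  proof -
    obtain i j where w: "w = i *\<^sub>R e + j *\<^sub>R f" using cross2_basis[OF nc] by blast
    have "qform p q s w = i\<^sup>2 * qform p q s e + 2 * (i * j * bform p q s e f) + j\<^sup>2 * qform p q s f"
      for p q s
      unfolding w by (simp add: qform_def bform_def algebra_simps power2_eq_square)
    then show ?thesis using e f bef by (simp add: algebra_simps)
  qed
  have lin: "?b' (A - z') w = m * ?b (A - z) w" for w
  proof -
    obtain i j where w: "w = i *\<^sub>R e + j *\<^sub>R f" using cross2_basis[OF nc] by blast
    have "?b' (A - z') e = m * ?b (A - z) e" "?b' (A - z') f = m * ?b (A - z) f"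
      using conic_bform_chord[OF on(1,2)] conic_bform_chord[OF on'(1,2)]
        conic_bform_chord[OF on(1,3)] conic_bform_chord[OF on'(1,3)] e f
      unfolding ef[symmetric] by simp_all
    then show ?thesis unfolding w by (simp add: bform_linear algebra_simps)
  qed
  have F: "?Q' (x - z') - 1 = m * (?Q (x - z) - 1)" for x
  proof -
    have expand: "qform p q s (x - z) - 1 = 2 * bform p q s (A - z) (x - A) + qform p q s (x - A)"
      if "A \<in> central_conic p q s z" for p q s z
      using that qform_add[of p q s "A - z" "x - A"] by (simp add: central_conic_def)
    show ?thesis
      unfolding expand[OF on(1)] expand[OF on'(1)] unfolding Q lin by (simp add: distrib_left)
  qed
  show "central_conic p' q' s' z' = central_conic p q s z"
  proof -
    have "?Q' (x - z') - 1 = 0 \<longleftrightarrow> ?Q (x - z) - 1 = 0" for x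
      unfolding F using m by simp
    then show ?thesis unfolding central_conic_def by simp
  qed
  \<comment> \<open>Both polynomials have minimum \<open>-1\<close>, attained at their centres, which forces \<open>m = 1\<close>.\<close>
  have nonneg: "0 \<le> ?Q w" "0 \<le> ?Q' w" for w
    using qform_pos[OF pd, of w] qform_pos[OF pd', of w]
    by (cases "w = 0"; simp add: qform_def bform_def)+
  have zero: "qform p q s (x - x) = 0" for p q s and x :: "real ^ 2"
    by (simp add: qform_def bform_def)
  have "m = 1"
  proof (rule antisym)
    show "m \<le> 1" using F[of z] nonneg(2)[of "z - z'"] unfolding zero by simp
    have "m * ?Q (z' - z) = m - 1"
      using F[of z'] unfolding zero by (simp add: algebra_simps)
    moreover have "0 \<le> m * ?Q (z' - z)" using m nonneg(1) by simp
    ultimately show "1 \<le> m" by linarith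
  qed
  then have eq: "?Q' w = ?Q w" for w using Q by simp
  show p: "p' = p" using eq[of "vector [1, 0]"] by (simp add: qform_def bform_def)
  show s: "s' = s" using eq[of "vector [0, 1]"] by (simp add: qform_def bform_def)
  show "q' = q" using eq[of "vector [1, 1]"] p s by (simp add: qform_def bform_def)
qed

text \<open>Every positive definite Gram matrix \<open>\<alpha>, \<gamma>, \<beta>\<close> on the basis \<open>e, f\<close> belongs, up to a factor, to an
  ellipse through \<open>A\<close>, \<open>A + e\<close>, \<open>A + f\<close>: the circumcircle of this triangle in the metric of the form.
  The factor \<open>k\<close> normalises the circumradius to \<open>1\<close>.\<close>

lemma circumscribed_conic_exists:
  assumes nc: "cross2 e f \<noteq> 0" and pos: "0 < \<alpha>" "0 < \<beta>" "\<gamma>\<^sup>2 < \<alpha> * \<beta>"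
  obtains p q s z k where "0 < p" "q\<^sup>2 < p * s" "0 < k"
    "A \<in> central_conic p q s z" "A + e \<in> central_conic p q s z" "A + f \<in> central_conic p q s z"
    "qform p q s e = k * \<alpha>" "qform p q s f = k * \<beta>" "bform p q s e f = k * \<gamma>"
proof -
  define X where "X = cross2 e f"
  \<comment> \<open>The Gram matrix on \<open>e, f\<close> is carried back to the standard basis by the inverse of the matrix with
    columns \<open>e, f\<close>.\<close>
  define p q s where pqs:
    "p = (\<alpha> * (f $ 2)\<^sup>2 - 2 * \<gamma> * e $ 2 * f $ 2 + \<beta> * (e $ 2)\<^sup>2) / X\<^sup>2"
    "q = - (\<alpha> * f $ 1 * f $ 2 - \<gamma> * (e $ 1 * f $ 2 + e $ 2 * f $ 1) + \<beta> * e $ 1 * e $ 2) / X\<^sup>2"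
    "s = (\<alpha> * (f $ 1)\<^sup>2 - 2 * \<gamma> * e $ 1 * f $ 1 + \<beta> * (e $ 1)\<^sup>2) / X\<^sup>2"
  have X: "X \<noteq> 0" using nc by (simp add: X_def)
  have val: "qform p q s e = \<alpha>" "qform p q s f = \<beta>" "bform p q s e f = \<gamma>"
  proof -
    have num: "p * X\<^sup>2 = \<alpha> * (f $ 2)\<^sup>2 - 2 * \<gamma> * e $ 2 * f $ 2 + \<beta> * (e $ 2)\<^sup>2"
      "q * X\<^sup>2 = - (\<alpha> * f $ 1 * f $ 2 - \<gamma> * (e $ 1 * f $ 2 + e $ 2 * f $ 1) + \<beta> * e $ 1 * e $ 2)"
      "s * X\<^sup>2 = \<alpha> * (f $ 1)\<^sup>2 - 2 * \<gamma> * e $ 1 * f $ 1 + \<beta> * (e $ 1)\<^sup>2"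
      using X by (simp_all add: pqs)
    have exp: "bform p q s x y * X\<^sup>2 = (p * X\<^sup>2) * x $ 1 * y $ 1
        + (q * X\<^sup>2) * (x $ 1 * y $ 2 + x $ 2 * y $ 1) + (s * X\<^sup>2) * x $ 2 * y $ 2" for x y
      by (simp add: bform_def algebra_simps)
    have "bform p q s e e * X\<^sup>2 = \<alpha> * X\<^sup>2" "bform p q s f f * X\<^sup>2 = \<beta> * X\<^sup>2"
      "bform p q s e f * X\<^sup>2 = \<gamma> * X\<^sup>2"
      unfolding exp num unfolding X_def cross2_def by algebra+
    then show "qform p q s e = \<alpha>" "qform p q s f = \<beta>" "bform p q s e f = \<gamma>"
      using X by (simp_all add: qform_def)
  qed
  define D where "D = \<alpha> * \<beta> - \<gamma>\<^sup>2"
  have D: "0 < D" using pos by (simp add: D_def)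
  have "(p * s - q\<^sup>2) * X\<^sup>2 = D"
    using qform_det_in_basis[of p q s e f] unfolding val X_def D_def by simp
  then have det: "q\<^sup>2 < p * s" using D X zero_less_mult_pos2[of "p * s - q\<^sup>2" "X\<^sup>2"] by simp
  have p: "0 < p"
  proof -
    have "vector [f $ 2, - e $ 2] \<noteq> (0 :: real ^ 2)"
      using X by (auto simp: X_def cross2_def vec2_eq_iff)
    then have "0 < qform \<alpha> \<gamma> \<beta> (vector [f $ 2, - e $ 2])" using qform_pos pos by blast
    also have "qform \<alpha> \<gamma> \<beta> (vector [f $ 2, - e $ 2]) = p * X\<^sup>2"
    proof -
      have "p * X\<^sup>2 = \<alpha> * (f $ 2)\<^sup>2 - 2 * \<gamma> * e $ 2 * f $ 2 + \<beta> * (e $ 2)\<^sup>2"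
        using X by (simp add: pqs)
      then show ?thesis by (simp add: qform_def bform_def power2_eq_square algebra_simps)
    qed
    finally show ?thesis using X by (simp add: zero_less_mult_iff)
  qed
  \<comment> \<open>Cramer's rule for the circumcentre \<open>A + w\<close>, given by \<open>2 B (w, e) = Q e\<close> and \<open>2 B (w, f) = Q f\<close>.\<close>
  define w where "w = (\<beta> * (\<alpha> - \<gamma>) / (2 * D)) *\<^sub>R e + (\<alpha> * (\<beta> - \<gamma>) / (2 * D)) *\<^sub>R f"
  have we: "bform p q s w e = \<alpha> / 2" and wf: "bform p q s w f = \<beta> / 2"
  proof -
    have "bform p q s e w = (\<beta> * (\<alpha> - \<gamma>) / (2 * D)) * \<alpha> + (\<alpha> * (\<beta> - \<gamma>) / (2 * D)) * \<gamma>"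
      using val unfolding w_def bform_linear qform_def by simp
    also have "\<dots> = \<alpha> / 2" using D by (simp add: field_simps) (simp add: D_def algebra_simps power2_eq_square)
    finally show "bform p q s w e = \<alpha> / 2" by (simp add: bform_commute)
    have "bform p q s f w = (\<beta> * (\<alpha> - \<gamma>) / (2 * D)) * \<gamma> + (\<alpha> * (\<beta> - \<gamma>) / (2 * D)) * \<beta>"
      using val unfolding w_def bform_linear qform_def bform_commute[of p q s f e] by simp
    also have "\<dots> = \<beta> / 2" using D by (simp add: field_simps) (simp add: D_def algebra_simps power2_eq_square)
    finally show "bform p q s w f = \<beta> / 2" by (simp add: bform_commute)
  qed
  have "w \<noteq> 0" using we pos by (auto simp: bform_def)
  define h where "h = qform p q s w"
  have h: "0 < h" using qform_pos[OF p det \<open>w \<noteq> 0\<close>] by (simp add: h_def)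
  have sc: "qform (p / h) (q / h) (s / h) x = qform p q s x / h"
    "bform (p / h) (q / h) (s / h) x y = bform p q s x y / h" for x y
    by (simp_all add: qform_def bform_def add_divide_distrib)
  show ?thesis
  proof
    show "0 < p / h" "0 < 1 / h" using p h by simp_all
    show "(q / h)\<^sup>2 < p / h * (s / h)"
      using det h by (simp add: power2_eq_square divide_strict_right_mono)
    have "qform p q s (e - w) = h" "qform p q s (f - w) = h" "qform p q s (- w) = h"
      using we wf val bform_commute[of p q s w]
      by (simp_all add: qform_diff qform_minus h_def)
    then show "A \<in> central_conic (p / h) (q / h) (s / h) (A + w)"
      "A + e \<in> central_conic (p / h) (q / h) (s / h) (A + w)"
      "A + f \<in> central_conic (p / h) (q / h) (s / h) (A + w)"
      using h by (simp_all add: central_conic_def sc)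
    show "qform (p / h) (q / h) (s / h) e = 1 / h * \<alpha>" "qform (p / h) (q / h) (s / h) f = 1 / h * \<beta>"
      "bform (p / h) (q / h) (s / h) e f = 1 / h * \<gamma>"
      using val by (simp_all add: sc)
  qed
qed

lemma norm_strict_triangle:
  assumes "cross2 e f \<noteq> 0"
  shows "norm (e - f) < norm e + norm f"
proof -
  have "\<bar>e \<bullet> f\<bar> < norm e * norm f" by (rule abs_inner_less_norm_mult[OF assms])
  moreover have "(norm (e - f))\<^sup>2 = (norm e)\<^sup>2 - 2 * (e \<bullet> f) + (norm f)\<^sup>2"
    unfolding norm2_sq inner_2 by (simp add: power2_eq_square algebra_simps)
  ultimately have "(norm (e - f))\<^sup>2 < (norm e + norm f)\<^sup>2"
    unfolding power2_sum by linarith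
  then show ?thesis by (rule power2_less_imp_less) simp
qed

lemma circumbilliard_exists:
  assumes "nondegenerate_triangle A B C"
  obtains p q s z where "0 < p" "q\<^sup>2 < p * s" "billiard_3_periodic (central_conic p q s z) A B C"
proof -
  define e f where ef: "e = B - A" "f = C - A"
  define a b c where abc: "a = norm (f - e)" "b = norm f" "c = norm e"
  have nc: "cross2 e f \<noteq> 0"
    using assms by (simp add: nondegenerate_triangle_def collinear_iff_cross2 ef)
  have bc: "0 < b" "0 < c" and a: "0 < a"
    using cross2_nonzero_imp[OF nc] by (auto simp: abc)
  have tri: "a < b + c"
    using norm_strict_triangle[OF nc] norm_minus_commute[of e f] by (simp add: abc)
  have "cross2 e (e - f) \<noteq> 0" "cross2 f (f - e) \<noteq> 0"
    using nc by (simp_all add: cross2_def algebra_simps)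
  from this[THEN norm_strict_triangle] have tri2: "b < c + a" "c < b + a"
    using norm_minus_commute[of e f] by (simp_all add: abc)
  \<comment> \<open>A form with values \<open>c, b, a\<close> at \<open>e, f, f - e\<close> has this value at the pair \<open>e, f\<close>; it is
    positive definite because multiplying the strict triangle inequalities by \<open>a, b, c\<close> and adding them
    gives \<open>a\<^sup>2 + b\<^sup>2 + c\<^sup>2 < 2 a b + 2 b c + 2 c a\<close>.\<close>
  define g where "g = (b + c - a) / 2"
  have g: "g\<^sup>2 < c * b"
  proof -
    have "a * a < a * (b + c)" "b * b < b * (c + a)" "c * c < c * (b + a)"
      using tri tri2 a bc by simp_all
    then show ?thesis
      by (simp add: g_def power2_eq_square field_simps)
  qed
  obtain p q s z k where pd: "0 < p" "q\<^sup>2 < p * s" and k: "0 < k"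
    and on: "A \<in> central_conic p q s z" "A + e \<in> central_conic p q s z" "A + f \<in> central_conic p q s z"
    and val: "qform p q s e = k * c" "qform p q s f = k * b" "bform p q s e f = k * g"
    by (rule circumscribed_conic_exists[OF nc bc(2) bc(1) g, where A = A])
  have "qform p q s (f - e) = k * b - 2 * (k * g) + k * c"
    using val by (simp add: qform_diff bform_commute[of p q s f e])
  also have "\<dots> = k * a" by (simp add: g_def field_simps)
  finally have "qform p q s (C - B) = k * norm (C - B)" by (simp add: ef abc)
  moreover have "qform p q s (A - C) = k * norm (A - C)" "qform p q s (B - A) = k * norm (B - A)"
    using val qform_minus_commute[of p q s A C] norm_minus_commute[of A C]
    by (simp_all add: ef abc)
  ultimately have "billiard_3_periodic (central_conic p q s z) A B C"
    unfolding billiard_3_periodic_conic_iff[OF pd] using assms on k by (auto simp: ef)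
  then show ?thesis using that pd by blast
qed

lemma circumbilliard_eq:
  assumes "billiard_3_periodic E A B C"
  shows "circumbilliard A B C = E"
  unfolding circumbilliard_def
proof (rule the_equality)
  show "billiard_3_periodic E A B C" by (fact assms)
next
  fix E' assume "billiard_3_periodic E' A B C"
  moreover have "\<exists>p q s z. 0 < p \<and> q\<^sup>2 < p * s \<and> E = central_conic p q s z"
    if "billiard_3_periodic E A B C" for E
    using that conic_of_semi_axes unfolding billiard_3_periodic_def is_ellipse_def by metis
  ultimately show "E' = E" using assms circumbilliard_form_unique(1) by metis
qed

text \<open>The reciprocal squares of the semi-axes are the roots of a quadratic with coefficients \<open>tr Q\<close> and
  \<open>det Q\<close>, and the form \<open>Q\<close> of a circumbilliard is unique; the order \<open>b \<le> a\<close> tells the roots apart.\<close>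

lemma semi_axes_of_billiard_unique:
  assumes bil: "billiard_3_periodic E A B C"
    and ax: "has_semi_axes E a b" and ax': "has_semi_axes E a' b'"
  shows "a' = a" "b' = b"
proof -
  obtain p q s z where 1: "0 < p" "q\<^sup>2 < p * s" "E = central_conic p q s z"
    "p + s = 1 / a\<^sup>2 + 1 / b\<^sup>2" "p * s - q\<^sup>2 = (1 / a\<^sup>2) * (1 / b\<^sup>2)"
    using conic_of_semi_axes[OF ax] by metis
  obtain p' q' s' z' where 2: "0 < p'" "q'\<^sup>2 < p' * s'" "E = central_conic p' q' s' z'"
    "p' + s' = 1 / a'\<^sup>2 + 1 / b'\<^sup>2" "p' * s' - q'\<^sup>2 = (1 / a'\<^sup>2) * (1 / b'\<^sup>2)"
    using conic_of_semi_axes[OF ax'] by metis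
  have same: "p' = p" "q' = q" "s' = s"
    using circumbilliard_form_unique(2-4)[OF 1(1,2) 2(1,2)] bil 1(3) 2(3) by metis+
  have ab: "0 < b" "b \<le> a" "0 < b'" "b' \<le> a'"
    using ax ax' by (simp_all add: has_semi_axes_def)
  define x y x' y' where xy: "x = 1 / a\<^sup>2" "y = 1 / b\<^sup>2" "x' = 1 / a'\<^sup>2" "y' = 1 / b'\<^sup>2"
  have le: "x \<le> y" "x' \<le> y'" using ab by (auto simp: xy intro!: divide_left_mono power_mono)
  have sum: "x + y = x' + y'" and prod: "x * y = x' * y'"
    using 1 2 same by (simp_all add: xy)
  have "(x - x') * (x - y') = 0" using sum prod by algebra
  then have "x = x'" "y = y'" using le sum by auto
  then have "a'\<^sup>2 = a\<^sup>2" "b'\<^sup>2 = b\<^sup>2" using ab by (simp_all add: xy)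
  then show "a' = a" "b' = b" using ab by (simp_all add: power2_eq_iff_nonneg)
qed

lemma circumbilliard_ratio_eq:
  assumes "billiard_3_periodic E A B C" "has_semi_axes E a b"
  shows "circumbilliard_ratio (A, B, C) = a / b"
proof -
  have "semi_major E = a"
    unfolding semi_major_def using assms semi_axes_of_billiard_unique by (blast intro!: the_equality)
  moreover have "semi_minor E = b"
    unfolding semi_minor_def using assms semi_axes_of_billiard_unique by (blast intro!: the_equality)
  ultimately show ?thesis
    by (simp add: circumbilliard_ratio_def circumbilliard_eq[OF assms(1)])
qed

section \<open>Inradius and circumradius\<close>

text \<open>The circle is itself a conic, so tangency makes the radius to \<open>P\<close> perpendicular to the line. The
  left-hand side is then twice the area of the triangle \<open>I B C\<close>, with base \<open>C - B\<close> and height \<open>r\<close>.\<close>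

lemma tangent_distance:
  assumes "tangent_line_at (sphere I r) P (affine hull {B, C})" "0 < r"
  shows "\<bar>cross2 (C - B) (I - B)\<bar> = r * norm (C - B)"
proof -
  obtain Q where Q: "Q \<noteq> P" and h: "affine hull {B, C} = affine hull {P, Q}"
    and int: "affine hull {B, C} \<inter> sphere I r = {P}"
    using assms(1) unfolding tangent_line_at_def by blast
  have sph: "sphere I r = central_conic (1 / r\<^sup>2) 0 (1 / r\<^sup>2) I"
  proof -
    have form: "qform (1 / r\<^sup>2) 0 (1 / r\<^sup>2) y = (norm y)\<^sup>2 / r\<^sup>2" for y
      unfolding norm2_sq by (simp add: qform_def bform_def add_divide_distrib power2_eq_square)
    have "x \<in> sphere I r \<longleftrightarrow> (norm (x - I))\<^sup>2 = r\<^sup>2" for x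
      using assms(2) by (simp add: dist_norm norm_minus_commute power2_eq_iff_nonneg)
    then show ?thesis using assms(2) by (auto simp: central_conic_def form)
  qed
  have P: "P \<in> sphere I r" using int by blast
  have "bform (1 / r\<^sup>2) 0 (1 / r\<^sup>2) (P - I) (Q - P) = 0"
    using tangent_line_at_conic[of "1 / r\<^sup>2" 0 "1 / r\<^sup>2" P I "Q - P"] assms P Q
    unfolding h sph by simp
  moreover have "bform (1 / r\<^sup>2) 0 (1 / r\<^sup>2) x y = (x \<bullet> y) / r\<^sup>2" for x y
    by (simp add: bform_def inner_2 add_divide_distrib)
  ultimately have perp: "(P - I) \<bullet> (Q - P) = 0" using assms(2) by simp
  define w where "w = Q - P"
  have "B \<in> affine hull {P, Q}" "C \<in> affine hull {P, Q}"
    using h by (metis hull_inc insertI1 insert_commute)+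
  then obtain i j where B: "B = P + i *\<^sub>R w" and C: "C = P + j *\<^sub>R w"
    by (auto simp: affine_hull_2_alt w_def)
  have nP: "(norm (P - I))\<^sup>2 = r\<^sup>2" using P by (simp add: dist_norm norm_minus_commute)
  have "(cross2 (C - B) (I - B))\<^sup>2 = (j - i)\<^sup>2 * ((norm w)\<^sup>2 * (norm (P - I))\<^sup>2 - ((P - I) \<bullet> w)\<^sup>2)"
    unfolding B C cross2_def norm2_sq inner_2 by (simp, algebra)
  also have "\<dots> = (r * norm (C - B))\<^sup>2"
  proof -
    have "C - B = (j - i) *\<^sub>R w" by (simp add: B C algebra_simps)
    then show ?thesis using perp nP by (simp add: w_def power_mult_distrib)
  qed
  finally have "\<bar>cross2 (C - B) (I - B)\<bar>\<^sup>2 = (r * norm (C - B))\<^sup>2" by simp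
  then show ?thesis using assms(2) by (simp only: power2_eq_iff_nonneg abs_ge_zero norm_ge_zero
        mult_nonneg_nonneg less_imp_le)
qed

text \<open>Twice the area equals \<open>r\<close> times the perimeter, by cutting the triangle at the incentre. The cut
  pieces add up because the barycentric coordinates of \<open>I\<close> are nonnegative, which is where the
  circle lying inside the triangle excludes the excircles.\<close>

lemma cross2_eq_inradius_times_perimeter:
  assumes "is_incircle I r A B C"
  shows "\<bar>cross2 (B - A) (C - A)\<bar> = r * (norm (C - B) + norm (A - C) + norm (B - A))"
proof -
  have r: "0 < r" and sub: "sphere I r \<subseteq> convex hull {A, B, C}"
    using assms by (simp_all add: is_incircle_def)
  have a: "\<bar>cross2 (C - B) (I - B)\<bar> = r * norm (C - B)"
    and b: "\<bar>cross2 (A - C) (I - C)\<bar> = r * norm (A - C)"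
    and c: "\<bar>cross2 (B - A) (I - A)\<bar> = r * norm (B - A)"
    using assms tangent_distance r unfolding is_incircle_def by blast+
  \<comment> \<open>The centre is the midpoint of two antipodal points of the circle, so it lies in the triangle.\<close>
  define v :: "real ^ 2" where "v = r *\<^sub>R axis 1 1"
  have v: "norm v = r" using r by (simp add: v_def)
  have "I + v \<in> convex hull {A, B, C}" "I - v \<in> convex hull {A, B, C}"
    using sub v by (auto simp: dist_norm)
  then have "(1/2) *\<^sub>R (I + v) + (1/2) *\<^sub>R (I - v) \<in> convex hull {A, B, C}"
    by (intro convexD[OF convex_convex_hull]) simp_all
  also have "(1/2) *\<^sub>R (I + v) + (1/2) *\<^sub>R (I - v) = I"
    by (simp add: vec2_eq_iff field_simps)
  finally obtain x y z where xyz: "0 \<le> x" "0 \<le> y" "0 \<le> z" "x + y + z = 1"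
    and I: "I = x *\<^sub>R A + y *\<^sub>R B + z *\<^sub>R C"
    unfolding convex_hull_3 by blast
  define X where "X = cross2 (B - A) (C - A)"
  have x: "x = 1 - y - z" using xyz by simp
  have "cross2 (C - B) (I - B) = x * X" "cross2 (A - C) (I - C) = y * X"
    "cross2 (B - A) (I - A) = z * X"
    unfolding I X_def cross2_def x by (simp_all add: algebra_simps)
  then have "x * \<bar>X\<bar> + y * \<bar>X\<bar> + z * \<bar>X\<bar> = r * norm (C - B) + r * norm (A - C) + r * norm (B - A)"
    using a b c xyz by (simp add: abs_mult)
  moreover have "x * \<bar>X\<bar> + y * \<bar>X\<bar> + z * \<bar>X\<bar> = \<bar>X\<bar>"
    by (simp add: x algebra_simps)
  ultimately show ?thesis by (simp add: X_def algebra_simps)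
qed

text \<open>The classical \<open>a b c = 4 R \<Delta>\<close>. For the circumcentre \<open>A + w\<close> the products \<open>w \<bullet> e = |e|\<^sup>2 / 2\<close> and
  \<open>w \<bullet> f = |f|\<^sup>2 / 2\<close> are known, and the vanishing Gram determinant of \<open>w, e, f\<close> in the plane expresses
  \<open>|w|\<^sup>2\<close> through them.\<close>

lemma side_product_eq_circumradius:
  assumes "is_circumcircle O' R A B C"
  shows "norm (C - B) * norm (A - C) * norm (B - A) = 2 * R * \<bar>cross2 (B - A) (C - A)\<bar>"
proof -
  define e f w where efw: "e = B - A" "f = C - A" "w = O' - A"
  have R: "0 < R" and on: "norm w = R" "norm (w - e) = R" "norm (w - f) = R"
    using assms by (auto simp: is_circumcircle_def dist_norm efw)
  have polar: "(norm (w - x))\<^sup>2 = (norm w)\<^sup>2 - 2 * (w \<bullet> x) + (norm x)\<^sup>2" for x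
    unfolding norm2_sq inner_2 by (simp add: power2_eq_square algebra_simps)
  have we: "2 * (w \<bullet> e) = (norm e)\<^sup>2" and wf: "2 * (w \<bullet> f) = (norm f)\<^sup>2"
    using polar[of e] polar[of f] on by simp_all
  have fe: "(norm (f - e))\<^sup>2 = (norm e)\<^sup>2 + (norm f)\<^sup>2 - 2 * (e \<bullet> f)"
    unfolding norm2_sq inner_2 by (simp add: power2_eq_square algebra_simps)
  have gram: "(norm w)\<^sup>2 * (cross2 e f)\<^sup>2 =
      (w \<bullet> e)\<^sup>2 * (norm f)\<^sup>2 - 2 * (w \<bullet> e) * (w \<bullet> f) * (e \<bullet> f) + (w \<bullet> f)\<^sup>2 * (norm e)\<^sup>2"
    unfolding norm2_sq inner_2 cross2_def by algebra
  have "(2 * R * \<bar>cross2 e f\<bar>)\<^sup>2 = 4 * ((norm w)\<^sup>2 * (cross2 e f)\<^sup>2)"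
    by (simp add: on power_mult_distrib)
  also have "\<dots> = (norm (f - e))\<^sup>2 * (norm f)\<^sup>2 * (norm e)\<^sup>2"
    using we wf unfolding gram fe by algebra
  also have "\<dots> = (norm (f - e) * norm f * norm e)\<^sup>2"
    by (simp only: power_mult_distrib)
  finally have "norm (f - e) * norm f * norm e = 2 * R * \<bar>cross2 e f\<bar>"
    using R by (simp add: power2_eq_iff_nonneg)
  then show ?thesis by (simp add: efw norm_minus_commute[of A C])
qed

section \<open>The axis ratio\<close>

lemma heron_cross2:
  fixes e f :: "real ^ 2"
  defines "a \<equiv> norm (f - e)" and "b \<equiv> norm f" and "c \<equiv> norm e"
  shows "4 * (cross2 e f)\<^sup>2 = (a + b + c) * (b + c - a) * (c + a - b) * (a + b - c)"
proof -
  have ip: "2 * (e \<bullet> f) = b\<^sup>2 + c\<^sup>2 - a\<^sup>2"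
    unfolding assms norm2_sq inner_2 by (simp add: power2_eq_square algebra_simps)
  have "4 * (cross2 e f)\<^sup>2 = 4 * b\<^sup>2 * c\<^sup>2 - (2 * (e \<bullet> f))\<^sup>2"
    unfolding assms norm2_sq inner_2 cross2_def by algebra
  then show ?thesis unfolding ip by algebra
qed

text \<open>With \<open>\<sigma> = a + b + c\<close> and \<open>K = (b + c - a) (c + a - b) (a + b - c)\<close>, Heron's formula \<open>\<sigma> K = 4 X\<^sup>2\<close>
  and \<open>X = r \<sigma>\<close> give \<open>K = 4 r\<^sup>2 \<sigma>\<close>, while \<open>a b c = 2 R r \<sigma>\<close>. Both the determinant and the trace of \<open>Q\<close>
  are expressible in \<open>K\<close>, \<open>a b c\<close> and \<open>\<sigma>\<close>, and \<open>\<sigma>\<close> and \<open>l\<close> drop out of \<open>(tr Q)\<^sup>2 / det Q\<close>.\<close>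

lemma billiard_trace_det:
  assumes pd: "0 < p" "q\<^sup>2 < p * s" and bil: "billiard_3_periodic (central_conic p q s z) A B C"
    and ic: "is_incircle I r A B C" and cc: "is_circumcircle O' R A B C"
  shows "(p + s)\<^sup>2 * (r * (r + 4 * R)) = 4 * (r + R)\<^sup>2 * (p * s - q\<^sup>2)"
proof -
  define e f where ef: "e = B - A" "f = C - A"
  define a b c where abc: "a = norm (f - e)" "b = norm f" "c = norm e"
  obtain l where nc: "cross2 e f \<noteq> 0" and l: "0 < l" "qform p q s (f - e) = l * a"
    "qform p q s f = l * b" "qform p q s e = l * c"
    using bil unfolding billiard_3_periodic_conic_iff[OF pd] nondegenerate_triangle_def
      collinear_iff_cross2
    by (auto simp: ef abc qform_minus_commute[of p q s A C] norm_minus_commute[of A C])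
  define X where "X = \<bar>cross2 e f\<bar>"
  have X: "0 < X" and X2: "(cross2 e f)\<^sup>2 = X\<^sup>2" using nc by (simp_all add: X_def)
  have bef: "2 * bform p q s e f = l * (b + c - a)"
    using l qform_diff[of p q s f e] by (simp add: bform_commute algebra_simps)
  have ip: "2 * (e \<bullet> f) = b\<^sup>2 + c\<^sup>2 - a\<^sup>2"
    unfolding abc norm2_sq inner_2 by (simp add: power2_eq_square algebra_simps)
  have in1: "X = r * (a + b + c)" and r: "0 < r"
    using cross2_eq_inradius_times_perimeter[OF ic] ic norm_minus_commute[of A C]
    by (simp_all add: X_def ef abc is_incircle_def)
  have cr: "a * b * c = 2 * R * X" and R: "0 < R"
    using side_product_eq_circumradius[OF cc] cc norm_minus_commute[of A C]
    by (simp_all add: X_def ef abc is_circumcircle_def)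
  define \<sigma> K where "\<sigma> = a + b + c" and "K = (b + c - a) * (c + a - b) * (a + b - c)"
  have \<sigma>: "0 < \<sigma>" using X in1 r unfolding \<sigma>_def by (simp add: zero_less_mult_iff)
  have X\<sigma>: "X = r * \<sigma>" using in1 by (simp add: \<sigma>_def)
  have "\<sigma> * K = \<sigma> * (4 * r\<^sup>2 * \<sigma>)"
    using heron_cross2[of e f] unfolding X2 abc[symmetric] \<sigma>_def[symmetric] X\<sigma> K_def
    by algebra
  then have K: "K = 4 * r\<^sup>2 * \<sigma>" using \<sigma> by simp
  have P: "a * b * c = 2 * R * r * \<sigma>" using cr by (simp add: X\<sigma>)
  have det: "4 * (p * s - q\<^sup>2) * X\<^sup>2 = l\<^sup>2 * (4 * r\<^sup>2 + 16 * R * r)"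
  proof -
    have "4 * (p * s - q\<^sup>2) * X\<^sup>2 = 4 * (l * c) * (l * b) - (2 * bform p q s e f)\<^sup>2"
      using qform_det_in_basis[of p q s e f] l unfolding X2 by (simp add: algebra_simps power2_eq_square)
    also have "\<dots> = l\<^sup>2 * (4 * b * c - (b + c - a)\<^sup>2)"
      unfolding bef by algebra
    finally have 1: "4 * (p * s - q\<^sup>2) * X\<^sup>2 = l\<^sup>2 * (4 * b * c - (b + c - a)\<^sup>2)" .
    have "\<sigma> * (4 * b * c - (b + c - a)\<^sup>2) = K + 8 * (a * b * c)"
      unfolding \<sigma>_def K_def by algebra
    also have "\<dots> = \<sigma> * (4 * r\<^sup>2 + 16 * R * r)"
      unfolding K P by algebra
    finally have "4 * b * c - (b + c - a)\<^sup>2 = 4 * r\<^sup>2 + 16 * R * r" using \<sigma> by simp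
    with 1 show ?thesis by simp
  qed
  have tr: "2 * (p + s) * X\<^sup>2 = l * (4 * r * (r + R) * \<sigma>)"
  proof -
    have "2 * (p + s) * X\<^sup>2 = 2 * (l * c) * b\<^sup>2 + 2 * (l * b) * c\<^sup>2 - (2 * bform p q s e f) * (2 * (e \<bullet> f))"
      using qform_trace_in_basis[of p q s e f] l unfolding X2 abc by (simp add: algebra_simps)
    also have "\<dots> = l * (K + 2 * (a * b * c))"
      unfolding bef ip K_def by algebra
    also have "K + 2 * (a * b * c) = 4 * r * (r + R) * \<sigma>"
      unfolding K P by algebra
    finally show ?thesis .
  qed
  have "4 * X\<^sup>2 * X\<^sup>2 * ((p + s)\<^sup>2 * (r * (r + 4 * R)))
      = (2 * (p + s) * X\<^sup>2)\<^sup>2 * (r * (r + 4 * R))" by algebra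
  also have "\<dots> = l\<^sup>2 * (4 * r\<^sup>2 + 16 * R * r) * (4 * (r + R)\<^sup>2) * (r * \<sigma>)\<^sup>2"
    unfolding tr by algebra
  also have "\<dots> = 4 * X\<^sup>2 * X\<^sup>2 * (4 * (r + R)\<^sup>2 * (p * s - q\<^sup>2))"
    unfolding det[symmetric] X\<sigma>[symmetric] by algebra
  finally show ?thesis
    using mult_left_cancel[of "4 * X\<^sup>2 * X\<^sup>2"] X by fastforce
qed

text \<open>With \<open>T = \<rho> (\<rho> + 4)\<close> the equation is \<open>T k\<^sup>2 - 2 (\<rho>\<^sup>2 + 2) k + T = 0\<close>, with reduced discriminant
  \<open>4 (\<rho> + 1)\<^sup>2 (1 - 2 \<rho>)\<close>. The roots have product \<open>1\<close>, so \<open>k \<ge> 1\<close> selects the larger one. Euler's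
  inequality \<open>2 \<rho> \<le> 1\<close> comes out as the nonnegativity of this discriminant.\<close>

lemma axis_ratio_from_trace_det:
  fixes k \<rho> :: real
  assumes k: "1 \<le> k" and \<rho>: "0 < \<rho>" and eq: "(k + 1)\<^sup>2 * (\<rho> * (\<rho> + 4)) = 4 * (\<rho> + 1)\<^sup>2 * k"
  shows "k = (\<rho>\<^sup>2 + 2 * (\<rho> + 1) * sqrt (1 - 2 * \<rho>) + 2) / (\<rho> * (\<rho> + 4))"
proof -
  define T where "T = \<rho> * (\<rho> + 4)"
  have T: "0 < T" using \<rho> by (simp add: T_def)
  have ge: "0 \<le> k * T - (\<rho>\<^sup>2 + 2)"
  proof -
    have "(k\<^sup>2 + 1) * T = 2 * k * (\<rho>\<^sup>2 + 2)" using eq unfolding T_def by algebra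
    moreover have "(k\<^sup>2 + 1) * T \<le> 2 * k * (k * T)"
    proof -
      have "1 * 1 \<le> k * k" using k by (intro mult_mono) simp_all
      then have "(k\<^sup>2 + 1) * T \<le> (2 * k\<^sup>2) * T" using T by (intro mult_right_mono) (simp_all add: power2_eq_square)
      then show ?thesis by (simp add: power2_eq_square mult.assoc)
    qed
    ultimately have "2 * k * (\<rho>\<^sup>2 + 2) \<le> 2 * k * (k * T)" by simp
    then show ?thesis using k by simp
  qed
  have sq: "(k * T - (\<rho>\<^sup>2 + 2))\<^sup>2 = (2 * (\<rho> + 1))\<^sup>2 * (1 - 2 * \<rho>)"
    using eq unfolding T_def by algebra
  have "k * T - (\<rho>\<^sup>2 + 2) = sqrt ((2 * (\<rho> + 1))\<^sup>2 * (1 - 2 * \<rho>))"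
    unfolding sq[symmetric] using ge by simp
  also have "\<dots> = 2 * (\<rho> + 1) * sqrt (1 - 2 * \<rho>)"
    using \<rho> by (simp add: real_sqrt_mult)
  finally show ?thesis using T unfolding T_def[symmetric] by (simp add: field_simps)
qed

theorem theorem1:
  fixes ic oc :: "real ^ 2" and r R \<rho> :: real
  assumes "0 < r" and "0 < R" and "\<rho> = r / R"
  shows "circumbilliard_ratio constant_on poristic_family ic r oc R \<and>
    (\<forall>T \<in> poristic_family ic r oc R.
       circumbilliard_ratio T =
         sqrt ((\<rho>\<^sup>2 + 2 * (\<rho> + 1) * sqrt (1 - 2 * \<rho>) + 2) / (\<rho> * (\<rho> + 4))))"
proof -
  have ratio: "circumbilliard_ratio T =
      sqrt ((\<rho>\<^sup>2 + 2 * (\<rho> + 1) * sqrt (1 - 2 * \<rho>) + 2) / (\<rho> * (\<rho> + 4)))"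
    if T_in: "T \<in> poristic_family ic r oc R" for T
  proof -
    obtain A B C where T: "T = (A, B, C)" and nd: "nondegenerate_triangle A B C"
      and inc: "is_incircle ic r A B C" and cir: "is_circumcircle oc R A B C"
      using T_in unfolding poristic_family_def by blast
    obtain E where bil: "billiard_3_periodic E A B C" using circumbilliard_exists[OF nd] by metis
    then obtain a b where ax: "has_semi_axes E a b"
      by (auto simp: billiard_3_periodic_def is_ellipse_def)
    obtain p q s z where pd: "0 < p" "q\<^sup>2 < p * s" and E: "E = central_conic p q s z"
      and tr: "p + s = 1 / a\<^sup>2 + 1 / b\<^sup>2" and det: "p * s - q\<^sup>2 = (1 / a\<^sup>2) * (1 / b\<^sup>2)"
      using conic_of_semi_axes[OF ax] by metis
    have ab: "0 < b" "b \<le> a" using ax by (simp_all add: has_semi_axes_def)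
    define k where "k = (a / b)\<^sup>2"
    have k: "1 \<le> k" using ab by (simp add: k_def one_le_power)
    have r: "r = \<rho> * R" and \<rho>: "0 < \<rho>" using assms by simp_all
    have trk: "p + s = (k + 1) / a\<^sup>2" and detk: "p * s - q\<^sup>2 = k / (a\<^sup>2)\<^sup>2"
      unfolding tr det k_def using ab by (simp_all add: field_simps power2_eq_square)
    have "((k + 1) / a\<^sup>2)\<^sup>2 * (r * (r + 4 * R)) = 4 * (r + R)\<^sup>2 * (k / (a\<^sup>2)\<^sup>2)"
      using billiard_trace_det[OF pd bil[unfolded E] inc cir] unfolding trk detk .
    then have "(k + 1)\<^sup>2 * (r * (r + 4 * R)) = 4 * (r + R)\<^sup>2 * k"
      using ab by (simp add: power_divide)
    then have "R\<^sup>2 * ((k + 1)\<^sup>2 * (\<rho> * (\<rho> + 4))) = R\<^sup>2 * (4 * (\<rho> + 1)\<^sup>2 * k)"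
      unfolding r by algebra
    then have "(k + 1)\<^sup>2 * (\<rho> * (\<rho> + 4)) = 4 * (\<rho> + 1)\<^sup>2 * k"
      using assms(2) by simp
    from axis_ratio_from_trace_det[OF k \<rho> this]
    have "sqrt k = sqrt ((\<rho>\<^sup>2 + 2 * (\<rho> + 1) * sqrt (1 - 2 * \<rho>) + 2) / (\<rho> * (\<rho> + 4)))" by simp
    moreover have "sqrt k = circumbilliard_ratio T"
      using ab by (simp add: T circumbilliard_ratio_eq[OF bil ax] k_def)
    ultimately show ?thesis by simp
  qed
  then show ?thesis unfolding constant_on_def by blast
qed

end
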